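(* Let $|\nu|<\frac12$ and let $h_{\nu,1}$, $h_{\nu,1}'$ and $h_{\nu,1}''$ denote the first (smallest) positive zeros of $\mathbf{H}_\nu$, $\mathbf{H}_\nu'$ and $\mathbf{H}_\nu''$, respectively, where $\mathbf{H}_\nu$ is the Struve function of the first kind. Then $$h_{\nu,1}>\sqrt{3(2\nu+3)},\qquad h_{\nu,1}^2>3(2\nu+3)\sqrt{\frac{5(2\nu+5)}{7-2\nu}},$$ $$h_{\nu,1}'>\sqrt{\frac{3(\nu+1)(2\nu+3)}{\nu+3}},\qquad (h_{\nu,1}')^2>3(\nu+1)(2\nu+3)\sqrt{\frac{5(2\nu+5)}{-2\nu^3-5\nu^2+72\nu+135}},$$ and, provided that in addition $\nu>0$, $$h_{\nu,1}''>\sqrt{\frac{3\nu(\nu+1)(2\nu+3)}{(\nu+2)(\nu+3)}},\qquad (h_{\nu,1}'')^2>3\nu(\nu+1)(2\nu+3)\sqrt{\frac{5(2\nu+5)}{-2\nu^5-13\nu^4+92\nu^3+763\nu^2+1500\nu+900}}.$$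
   Context: The Struve function of the first kind is $\mathbf{H}_\nu(x)=\left(\frac{x}{2}\right)^{\nu+1}\sum_{m\ge0}\frac{(-1)^m}{\Gamma\left(m+\frac32\right)\Gamma\left(m+\nu+\frac32\right)}\left(\frac{x}{2}\right)^{2m}$; primes on $\mathbf{H}_\nu$ denote derivatives with respect to $x$. *)

theory Defs
  imports "HOL-Analysis.Analysis"
begin

(* Meant for x > 0, where powr is the usual real power.  Since Gamma is 0 at its
   poles and a / 0 = 0, the usual convention 1 / Gamma (-n) = 0 holds for every real nu. *)
definition struve_H :: "real \<Rightarrow> real \<Rightarrow> real" where
  "struve_H \<nu> x = (x / 2) powr (\<nu> + 1) *
     (\<Sum>m. (- 1) ^ m / (Gamma (real m + 3 / 2) * Gamma (real m + \<nu> + 3 / 2)) * (x / 2) ^ (2 * m))"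

(* An unspecified real if f has no smallest positive zero, so that proving a bound
   for this number includes proving that the zero exists. *)
definition first_pos_zero :: "(real \<Rightarrow> real) \<Rightarrow> real" where
  "first_pos_zero f = (LEAST x. 0 < x \<and> f x = 0)"

end

(* The normalised series of H_nu, H_nu' and H_nu'' in z = x^2 have the form
   f(z) = 1 - b1 z + b2 z^2 - ..., and the bounds say that z < 1 / b1 and z^2 < 1 / (b1^2 - 2 b2)
   contain no zero.  The second condition is the weaker one, so only positivity of f on
   (b1^2 - 2 b2) z^2 <= 1 is needed.  No product expansion over the zeros enters: there f dominates
   an even alternating partial sum (degree 3 for the derivatives, degree 5 for H_nu, where degree 3
   does not suffice), and with t = b1 z the latter is positive by an elementary inequality.

   The zeros exist because H_nu(2 pi) <= 0: up to a positive factor H_nu(x) is the integral over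
   (0, 1) of sin(x sqrt u) / sqrt u against the increasing weight (1 - u)^(nu - 1/2), and for
   x = 2 pi the sine factor has mean zero and changes sign once, from plus to minus.  Rolle's
   theorem then gives zeros of H_nu' and, for nu > 0, of H_nu''. *)

theory Submission
  imports Defs
begin

section \<open>Power series times a real power\<close>

text \<open>The common shape of H_nu, H_nu' and H_nu'' up to one constant factor: differentiation
  lowers \<open>p\<close> by one and multiplies \<open>c m\<close> by
  \<open>2 * real m + p\<close>.\<close>

definition frobenius_series :: "real \<Rightarrow> (nat \<Rightarrow> real) \<Rightarrow> real \<Rightarrow> real" where
  "frobenius_series p c x = x powr p * (\<Sum>m. c m * (x\<^sup>2) ^ m)"

lemma summable_real_diffs:
  fixes c :: "nat \<Rightarrow> real"
  assumes "\<And>y. summable (\<lambda>m. c m * y ^ m)"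
  shows "summable (\<lambda>m. diffs c m * y ^ m)"
  using termdiff_converges_all[of c y] assms by blast

text \<open>The Euler operator y d/dy on a power series: a factor \<open>y\<close> restores the
  exponents of the differentiated series. The truncated \<open>m - Suc 0\<close> is harmless at
  \<open>m = 0\<close>, where the factor \<open>real m\<close> vanishes.\<close>

lemma sums_mult_index:
  fixes c :: "nat \<Rightarrow> real"
  assumes "\<And>y. summable (\<lambda>m. c m * y ^ m)"
  shows "(\<lambda>m. real m * c m * y ^ m) sums (y * (\<Sum>m. diffs c m * y ^ m))"
proof -
  have "(\<lambda>m. real m * c m * y ^ (m - Suc 0)) sums (\<Sum>m. diffs c m * y ^ m)"
    using diffs_equiv[OF summable_real_diffs[OF assms, of y]] by simp
  from sums_mult[OF this, of y]
  have "(\<lambda>m. y * (real m * c m * y ^ (m - Suc 0))) sums (y * (\<Sum>m. diffs c m * y ^ m))" .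
  moreover have "y * (real m * c m * y ^ (m - Suc 0)) = real m * c m * y ^ m" for m
    by (cases m) auto
  ultimately show ?thesis by simp
qed

lemma summable_mult_affine:
  fixes c :: "nat \<Rightarrow> real"
  assumes "\<And>y. summable (\<lambda>m. c m * y ^ m)"
  shows "summable (\<lambda>m. (2 * real m + p) * c m * y ^ m)"
proof -
  have "summable (\<lambda>m. 2 * (real m * c m * y ^ m) + p * (c m * y ^ m))"
    using sums_summable[OF sums_mult_index[OF assms, of y]] assms[of y]
    by (intro summable_add summable_mult)
  thus ?thesis by (simp add: algebra_simps)
qed

text \<open>The product rule yields \<open>x powr (p - 1)\<close> times
  \<open>p * F y + 2 * y * F' y\<close> at y = x^2, and the Euler operator turns this into a single
  series.\<close>

lemma frobenius_series_has_derivative: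
  assumes c: "\<And>y. summable (\<lambda>m. c m * y ^ m)" and "0 < x"
  shows "(frobenius_series p c has_real_derivative frobenius_series (p - 1) (\<lambda>m. (2 * real m + p) * c m) x) (at x)"
proof -
  define F where "F y = (\<Sum>m. c m * y ^ m)" for y
  define F' where "F' y = (\<Sum>m. diffs c m * y ^ m)" for y
  have F: "(F has_real_derivative F' y) (at y)" for y
    unfolding F_def F'_def by (rule termdiffs_strong_converges_everywhere) (use c in blast)
  have "((\<lambda>x. x powr p * F (x\<^sup>2)) has_real_derivative
      (p * x powr (p - 1)) * F (x\<^sup>2) + F' (x\<^sup>2) * (2 * x) * x powr p) (at x)"
    by (rule DERIV_mult has_real_derivative_powr DERIV_chain2[OF F] assms
        derivative_eq_intros refl | simp)+
  moreover have "(p * x powr (p - 1)) * F (x\<^sup>2) + F' (x\<^sup>2) * (2 * x) * x powr p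
      = frobenius_series (p - 1) (\<lambda>m. (2 * real m + p) * c m) x"
  proof -
    have "(\<lambda>m. 2 * (real m * c m * y ^ m) + p * (c m * y ^ m)) sums (2 * (y * F' y) + p * F y)" for y
      unfolding F_def F'_def
      by (intro sums_add sums_mult sums_mult_index c summable_sums)
    hence "(\<Sum>m. (2 * real m + p) * c m * y ^ m) = 2 * (y * F' y) + p * F y" for y
      by (simp add: sums_iff algebra_simps)
    moreover have "x powr p = x * x powr (p - 1)"
      using \<open>0 < x\<close> by (simp add: powr_mult_base)
    ultimately show ?thesis
      unfolding frobenius_series_def by (simp only:) (simp only: algebra_simps power2_eq_square)
  qed
  ultimately show ?thesis unfolding frobenius_series_def F_def by (simp only:)
qed

text \<open>Positivity of \<open>p\<close> gives continuity at the endpoint 0, as required for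
  Rolle's theorem on [0, h].\<close>

lemma continuous_on_frobenius_series:
  assumes c: "\<And>y. summable (\<lambda>m. c m * y ^ m)" and "0 < p"
  shows "continuous_on {0..} (frobenius_series p c)"
proof -
  have "isCont (\<lambda>y. \<Sum>m. c m * y ^ m) y" for y
    by (rule DERIV_isCont, rule termdiffs_strong_converges_everywhere) (use c in blast)
  hence "continuous_on UNIV (\<lambda>y. \<Sum>m. c m * y ^ m)"
    by (simp add: continuous_at_imp_continuous_on)
  hence "continuous_on {0..} (\<lambda>x::real. \<Sum>m. c m * (x\<^sup>2) ^ m)"
    by (rule continuous_on_compose2) (auto intro!: continuous_intros)
  moreover have "continuous_on {0..} (\<lambda>x::real. x powr p)"
    using \<open>0 < p\<close> by (intro continuous_on_powr' continuous_on_id continuous_on_const) simp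
  ultimately show ?thesis
    unfolding frobenius_series_def by (intro continuous_on_mult)
qed

text \<open>For positive \<open>p\<close> the function vanishes at 0 as well as at \<open>h\<close>,
  so its derivative vanishes in between.\<close>

lemma frobenius_series_Rolle:
  assumes c: "\<And>y. summable (\<lambda>m. c m * y ^ m)" and "0 < p" "0 < h" "frobenius_series p c h = 0"
  obtains y where "0 < y" "frobenius_series (p - 1) (\<lambda>m. (2 * real m + p) * c m) y = 0"
proof -
  have "\<exists>y. 0 < y \<and> y < h \<and> (\<lambda>v. v * frobenius_series (p - 1) (\<lambda>m. (2 * real m + p) * c m) y) = (\<lambda>v. 0)"
  proof (rule Rolle_deriv)
    show "frobenius_series p c 0 = frobenius_series p c h" using assms by (simp add: frobenius_series_def)
    show "continuous_on {0..h} (frobenius_series p c)"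
      by (rule continuous_on_subset[OF continuous_on_frobenius_series]) (use assms in auto)
    fix x :: real assume "0 < x"
    from frobenius_series_has_derivative[OF c this, of p]
    show "(frobenius_series p c has_derivative (\<lambda>v. v * frobenius_series (p - 1) (\<lambda>m. (2 * real m + p) * c m) x)) (at x)"
      unfolding has_field_derivative_def
      by (rule has_derivative_eq_rhs) (simp add: fun_eq_iff mult.commute)
  qed fact
  then obtain y where "0 < y" and
    "(\<lambda>v. v * frobenius_series (p - 1) (\<lambda>m. (2 * real m + p) * c m) y) = (\<lambda>v. 0)" by blast
  from fun_cong[OF this(2), of 1] this(1) show ?thesis by (intro that) simp_all
qed

section \<open>Alternating series and first zeros\<close>

text \<open>The tail from an even index starts with a plus sign and its terms decrease to 0, so it
  is nonnegative by Leibniz. Monotonicity is asked only from \<open>n\<close> on, since the first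
  terms may grow for the arguments of interest.\<close>

lemma alternating_partial_sum_le:
  fixes a :: "nat \<Rightarrow> real"
  assumes "even n" and sm: "summable (\<lambda>m. (- 1) ^ m * a m)" and "\<And>m. 0 \<le> a m"
    and dec: "\<And>m. n \<le> m \<Longrightarrow> a (Suc m) \<le> a m"
  shows "(\<Sum>m<n. (- 1) ^ m * a m) \<le> (\<Sum>m. (- 1) ^ m * a m)"
proof -
  have "(\<lambda>m. (- 1) ^ m * a m) \<longlonglongrightarrow> 0" using sm by (rule summable_LIMSEQ_zero)
  hence "(\<lambda>m. \<bar>(- 1) ^ m * a m\<bar>) \<longlonglongrightarrow> 0" by (rule tendsto_rabs_zero)
  hence "a \<longlonglongrightarrow> 0" using assms(3) by (simp add: abs_mult)
  hence "(\<lambda>m. a (m + n)) \<longlonglongrightarrow> 0" by (rule LIMSEQ_ignore_initial_segment)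
  \<comment> \<open>The empty partial sum serves as the Leibniz lower bound, so the bound is
    0.\<close>
  hence "(\<Sum>m<2 * 0. (- 1) ^ m * a (m + n)) \<le> (\<Sum>m. (- 1) ^ m * a (m + n))"
    by (rule summable_Leibniz'(2)) (use assms in auto)
  moreover have "(- 1) ^ m * a (m + n) = (- 1) ^ (m + n) * a (m + n)" for m
    using \<open>even n\<close> by (simp add: power_add)
  ultimately have "0 \<le> (\<Sum>m. (- 1) ^ (m + n) * a (m + n))" by simp
  thus ?thesis using suminf_split_initial_segment[OF sm, of n] by simp
qed

text \<open>Positivity on (0, L] puts all positive zeros into the closed set of zeros in [L,
  \<infinity>). This set contains \<open>y\<close>, so its infimum is attained and is the least
  positive zero.\<close>

lemma first_pos_zero_gt:
  assumes cont: "continuous_on {0<..} f" and pos: "\<And>x. 0 < x \<Longrightarrow> x \<le> L \<Longrightarrow> 0 < f x"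
    and "0 < L" "0 < y" "f y = (0::real)"
  shows "L < first_pos_zero f"
proof -
  define Z where "Z = {x \<in> {L..}. f x = 0}"
  have "closed Z" unfolding Z_def
    by (rule continuous_closed_preimage_constant)
      (use \<open>0 < L\<close> in \<open>auto intro!: continuous_on_subset[OF cont]\<close>)
  have Z: "x \<in> Z" if "0 < x" "f x = 0" for x
    using pos[of x] that by (force simp: Z_def)
  have bdd: "bdd_below Z" by (auto simp: Z_def bdd_below_def)
  have "Inf Z \<in> Z"
    by (rule closed_contains_Inf) (use Z[of y] assms bdd \<open>closed Z\<close> in auto)
  have "first_pos_zero f = Inf Z"
    unfolding first_pos_zero_def
  proof (rule Least_equality)
    show "0 < Inf Z \<and> f (Inf Z) = 0"
      using \<open>Inf Z \<in> Z\<close> \<open>0 < L\<close> by (auto simp: Z_def)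
    show "Inf Z \<le> x" if "0 < x \<and> f x = 0" for x
      using Z[of x] that bdd by (auto intro: cInf_lower)
  qed
  moreover have "L \<le> Inf Z" "f (Inf Z) = 0" using \<open>Inf Z \<in> Z\<close> by (auto simp: Z_def)
  moreover have "L \<noteq> Inf Z" using pos[of L] \<open>0 < L\<close> calculation(3) by auto
  ultimately show ?thesis by simp
qed

section \<open>Two polynomial inequalities\<close>

text \<open>Applied with t = b1 z, \<beta> = b2 / b1^2 and \<gamma> = b3 / b1^3. The bound 5/18
  gives 1 - 2 \<beta> \<ge> 4/9, hence t \<le> 3/2. At the least admissible \<beta> the cubic has
  the factor (t - 1)^2, and its cofactor is positive up to t = 3/2 because 47/100 lies below
  48/100.\<close>

lemma cubic_pos:
  fixes \<beta> \<gamma> t :: real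
  assumes "0 < t" "0 < \<beta>" "\<beta> \<le> 5 / 18" "\<gamma> \<le> 47 / 100 * \<beta>\<^sup>2" "(1 - 2 * \<beta>) * t\<^sup>2 \<le> 1"
  shows "0 < 1 - t + \<beta> * t\<^sup>2 - \<gamma> * t ^ 3"
proof -
  have "4 / 9 * t\<^sup>2 \<le> (1 - 2 * \<beta>) * t\<^sup>2" using assms by (intro mult_right_mono) auto
  hence "t\<^sup>2 \<le> 9 / 4" using assms(5) by linarith
  hence "t\<^sup>2 \<le> (3 / 2)\<^sup>2" by (simp add: power_divide)
  hence t: "t \<le> 3 / 2" by (rule power2_le_imp_le) simp
  have "\<gamma> * t ^ 3 \<le> 47 / 100 * \<beta>\<^sup>2 * t ^ 3" using assms by (intro mult_right_mono) auto
  moreover have "0 < 1 - t + \<beta> * t\<^sup>2 - 47 / 100 * \<beta>\<^sup>2 * t ^ 3"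
  proof (cases "t \<le> 1")
    case True
    have "\<beta> * t < 1" using mult_mono[of \<beta> "5/18" t 1] assms True by auto
    hence "0 < \<beta> * t\<^sup>2 * (1 - 47 / 100 * (\<beta> * t))" using assms by simp
    also have "\<dots> = \<beta> * t\<^sup>2 - 47 / 100 * \<beta>\<^sup>2 * t ^ 3"
      by (simp add: algebra_simps power2_eq_square power3_eq_cube)
    finally show ?thesis using True by simp
  next
    case False
    \<comment> \<open>The last hypothesis reads \<open>\<beta>0 \<le> \<beta>\<close>, and the cubic increases with \<open>\<beta>\<close>.\<close>
    define \<beta>0 where "\<beta>0 = (t\<^sup>2 - 1) / (2 * t\<^sup>2)"
    have le: "\<beta>0 \<le> \<beta>" using assms by (simp add: \<beta>0_def field_simps)
    \<comment> \<open>The values at \<open>\<beta>\<close> and \<open>\<beta>0\<close> differ by a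
      multiple of \<open>\<beta> - \<beta>0\<close>; this bound makes the cofactor positive.\<close>
    have "(\<beta> + \<beta>0) * t \<le> (2 * (5 / 18)) * (3 / 2)"
      by (rule mult_mono) (use le t assms in auto)
    hence "0 \<le> t\<^sup>2 * ((\<beta> - \<beta>0) * (1 - 47 / 100 * ((\<beta> + \<beta>0) * t)))" using le by simp
    also have "\<dots> = (\<beta> * t\<^sup>2 - 47 / 100 * \<beta>\<^sup>2 * t ^ 3) - (\<beta>0 * t\<^sup>2 - 47 / 100 * \<beta>0\<^sup>2 * t ^ 3)"
      by (simp add: field_simps power2_eq_square power3_eq_cube)
    finally have "\<beta>0 * t\<^sup>2 - 47 / 100 * \<beta>0\<^sup>2 * t ^ 3 \<le> \<beta> * t\<^sup>2 - 47 / 100 * \<beta>\<^sup>2 * t ^ 3"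
      by simp
    moreover have "0 < 1 - t + \<beta>0 * t\<^sup>2 - 47 / 100 * \<beta>0\<^sup>2 * t ^ 3"
    proof -
      \<comment> \<open>The concave quadratic \<open>200 * t - 47 * (t + 1)\<^sup>2\<close> lies
        above its chord over [1, 3/2], whose end values are 12 and 25/4.\<close>
      have "0 \<le> (t - 1) * (3 / 2 - t)" using False t by simp
      hence "0 < 200 * t - 47 * (t + 1)\<^sup>2"
        using False t by (simp add: field_simps power2_eq_square)
      hence "0 < (t - 1)\<^sup>2 * (200 * t - 47 * (t + 1)\<^sup>2) / (400 * t)"
        using False by simp
      also have "\<dots> = 1 - t + (t\<^sup>2 - 1) / 2 - 47 / 100 * ((t\<^sup>2 - 1)\<^sup>2 / (4 * t))"
        using False by (simp add: field_simps power2_eq_square)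
      also have "(t\<^sup>2 - 1) / 2 = \<beta>0 * t\<^sup>2" using False by (simp add: \<beta>0_def)
      also have "47 / 100 * ((t\<^sup>2 - 1)\<^sup>2 / (4 * t)) = 47 / 100 * \<beta>0\<^sup>2 * t ^ 3"
        using False by (simp add: \<beta>0_def power_divide power_mult_distrib) (simp add: field_simps eval_nat_numeral)
      finally show ?thesis .
    qed
    ultimately show ?thesis by simp
  qed
  ultimately show ?thesis by simp
qed

text \<open>Here \<open>s = 2 \<nu> + 3\<close> and \<open>r m\<close> is the ratio \<open>b m / (b (m - 1) * b 1)\<close> of the coefficients of
  the normalised series of \<open>H_\<nu>\<close>.\<close>

lemma quintic_pos:
  fixes s t :: real
  defines "r \<equiv> (\<lambda>m. 3 * s / ((2 * m + 1) * (s + 2 * m - 2)))"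
  assumes "0 < t" "2 < s" "s < 4" "(10 - s) * t\<^sup>2 \<le> 5 * (s + 2)"
  shows "0 < 1 - t + r 2 * t\<^sup>2 * (1 - r 3 * t * (1 - r 4 * t * (1 - r 5 * t)))"
proof -
  have r: "r 2 = 3 * s / (5 * (s + 2))" "r 3 = 3 * s / (7 * (s + 4))"
    "r 4 = s / (3 * (s + 6))" "r 5 = 3 * s / (11 * (s + 8))"
    using assms by (simp_all add: r_def field_simps)
  have "6 * t\<^sup>2 \<le> (10 - s) * t\<^sup>2" using assms by (intro mult_right_mono) auto
  also have "\<dots> \<le> 5 * (s + 2)" by fact
  also have "\<dots> \<le> 30" using \<open>s < 4\<close> by simp
  finally have t2: "t\<^sup>2 \<le> 5" by simp
  \<comment> \<open>56/25 is a rational number slightly above the square root of 5.\<close>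
  hence "t\<^sup>2 \<le> (56 / 25)\<^sup>2" by (simp add: power_divide)
  hence t: "t \<le> 56 / 25" by (rule power2_le_imp_le) simp
  have r_bounds: "0 < r 2" "0 < r 3" "0 < r 4" "0 < r 5" "r 3 \<le> 3 / 14" "r 4 \<le> 2 / 15" "r 5 \<le> 1 / 11"
    using assms by (simp_all add: r field_simps)
  have "r 5 * t \<le> 1 / 11 * (56 / 25)" using r_bounds t assms by (intro mult_mono) auto
  hence r5: "r 5 * t \<le> 21 / 100" by simp
  \<comment> \<open>Since \<open>r 5 * t\<close> is at most 21/100, the innermost factor is at least
    79/100. Replacing it by 79/100 enlarges what is subtracted and removes the term of highest
    degree.\<close>
  define Y where "Y = 1 - 79 / 100 * r 4 * t"
  have "79 / 100 * (r 4 * t) \<le> (1 - r 5 * t) * (r 4 * t)"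
    using r5 r_bounds assms by (intro mult_right_mono) auto
  hence "1 - r 4 * t * (1 - r 5 * t) \<le> Y"
    by (simp add: Y_def algebra_simps)
  hence "r 2 * t\<^sup>2 * (1 - r 3 * t * Y)
     \<le> r 2 * t\<^sup>2 * (1 - r 3 * t * (1 - r 4 * t * (1 - r 5 * t)))"
    using r_bounds assms by (intro mult_left_mono diff_left_mono) auto
  moreover have "0 < 1 - t + r 2 * t\<^sup>2 * (1 - r 3 * t * Y)"
  proof (cases "t \<le> 1")
    case True
    have "r 3 * t * Y \<le> r 3 * t * 1"
      using r_bounds assms by (intro mult_left_mono) (auto simp: Y_def)
    also have "\<dots> \<le> 3 / 14 * 1 * 1"
      using r_bounds assms True by (intro mult_mono) auto
    finally have "r 3 * t * Y < 1" by simp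
    hence "0 < r 2 * t\<^sup>2 * (1 - r 3 * t * Y)"
      using r_bounds(1) \<open>0 < t\<close> by (intro mult_pos_pos) auto
    thus ?thesis using True by simp
  next
    case False
    have t1: "1 < t\<^sup>2" using False by simp
    have tp: "0 < t\<^sup>2 + 5" by (simp add: add_nonneg_pos)
    \<comment> \<open>The value of \<open>s\<close> for which the last hypothesis is an equality. The expression is minimal
      in \<open>s\<close> there, which leaves an inequality in \<open>t\<close> alone.\<close>
    define u where "u = 10 * (t\<^sup>2 - 1) / (t\<^sup>2 + 5)"
    have u: "0 < u" "u \<le> s" "u \<le> 4" using t1 tp assms t2 by (simp_all add: u_def field_simps)
    have t_pos: "0 < 4 * t\<^sup>2 + 5" "0 < 7 * t\<^sup>2 + 5" "0 < 6 * (4 * t\<^sup>2 + 5)"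
      by (simp_all add: add_nonneg_pos)
    have u_add: "u + 2 = 12 * t\<^sup>2 / (t\<^sup>2 + 5)" "u + 4 = 2 * (7 * t\<^sup>2 + 5) / (t\<^sup>2 + 5)"
      "u + 6 = 4 * (4 * t\<^sup>2 + 5) / (t\<^sup>2 + 5)"
      using tp by (simp_all add: u_def field_simps)
    \<comment> \<open>After the shift t = 1 + a the remaining polynomial inequalities are settled by
      dropping the nonnegative higher powers and bounding \<open>a\<close>, \<open>a\<^sup>2\<close>
      and \<open>a ^ 3\<close>.\<close>
    define a where "a = t - 1"
    have a: "0 \<le> a" "a \<le> 5 / 4" using False t by (auto simp: a_def)
    have ta: "t = 1 + a" by (simp add: a_def)
    have a2: "a\<^sup>2 \<le> 8 / 5" "a ^ 3 \<le> 2"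
      using power_mono[OF a(2,1), of 2] power_mono[OF a(2,1), of 3] by (simp_all add: power_divide)
    \<comment> \<open>\<open>r 4\<close> increases with \<open>s\<close>, so its value at
      \<open>u\<close> gives an upper bound for \<open>t * Y\<close> that depends on
      \<open>t\<close> alone. This leaves \<open>G\<close> as the only place where \<open>s\<close>
      enters.\<close>
    define c where "c = t * (1 - 79 / 100 * (u / (3 * (u + 6))) * t)"
    have "u / (3 * (u + 6)) \<le> r 4" using u by (simp add: r field_simps)
    hence "t * Y \<le> c" unfolding c_def Y_def
      using assms by (intro mult_left_mono diff_left_mono mult_right_mono) auto
    hence "r 2 * t\<^sup>2 * (1 - r 3 * c) \<le> r 2 * t\<^sup>2 * (1 - r 3 * t * Y)"
      using mult_left_mono[OF \<open>t * Y \<le> c\<close>, of "r 3"] r_bounds(1,2)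
      by (intro mult_left_mono) (auto simp: mult.assoc)
    define G where "G v = 3 * v / (5 * (v + 2)) * (1 - 3 * v / (7 * (v + 4)) * c)" for v
    have c_eq: "c * (6 * (4 * t\<^sup>2 + 5)) = t * (6 * (4 * t\<^sup>2 + 5) - 79 / 100 * (5 * (t\<^sup>2 - 1)) * t)"
    proof -
      have "u / (3 * (u + 6)) = 5 * (t\<^sup>2 - 1) / (6 * (4 * t\<^sup>2 + 5))"
      proof -
        have "10 * X / D / (3 * (4 * Y / D)) = 5 * X / (6 * Y)" if "0 < D" "0 < Y" for X Y D :: real
          using that by (simp add: field_simps)
        from this[OF tp t_pos(1)] show ?thesis unfolding u_add unfolding u_def .
      qed
      hence q: "u / (3 * (u + 6)) * (6 * (4 * t\<^sup>2 + 5)) = 5 * (t\<^sup>2 - 1)"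
        using t_pos by simp
      have "t * (1 - 79 / 100 * q * t) * e = t * (e - 79 / 100 * (q * e) * t)" for q e
        by (simp add: algebra_simps)
      thus ?thesis unfolding c_def q[symmetric] .
    qed
    \<comment> \<open>Monotonicity of \<open>G\<close> at s = u = 4 requires c \<le> 28/15, and
      186/100 is just below that.\<close>
    have "0 < (186 / 100 - c) * (6 * (4 * t\<^sup>2 + 5))"
    proof -
      have "0 < 4644 - 482 * a - 761 * a\<^sup>2 - 820 * a ^ 3 + 395 * a ^ 4"
        using a a2 zero_le_power[OF a(1), of 4] by linarith
      also have "\<dots> = 100 * (186 / 100 * (6 * (4 * t\<^sup>2 + 5)) -
          t * (6 * (4 * t\<^sup>2 + 5) - 79 / 100 * (5 * (t\<^sup>2 - 1)) * t))"
        unfolding ta by (simp add: eval_nat_numeral algebra_simps)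
      also have "\<dots> = 100 * ((186 / 100 - c) * (6 * (4 * t\<^sup>2 + 5)))"
        by (simp only: left_diff_distrib c_eq)
      finally show ?thesis by simp
    qed
    hence c: "c \<le> 186 / 100" using t_pos(3) zero_less_mult_pos2 by fastforce
    have "G u \<le> G s"
    proof -
      have "3 * (c * (6 * s * u + 8 * s + 8 * u)) \<le> 3 * (186 / 100 * (6 * s * u + 8 * s + 8 * u))"
        using u assms c by (intro mult_left_mono mult_right_mono) auto
      \<comment> \<open>Both sides are bilinear in \<open>s\<close> and \<open>u\<close>, so the
        corners of the square [0, 4]^2 decide; the four products below are the weights of the
        corners.\<close>
      also have "\<dots> \<le> 14 * (s + 4) * (u + 4)"
      proof -
        have "0 \<le> (4 - s) * (4 - u)" "0 \<le> (4 - s) * u" "0 \<le> s * (4 - u)" "0 \<le> s * u"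
          using u assms by auto
        thus ?thesis by (simp add: field_simps)
      qed
      finally have "0 \<le> 3 * (s - u) * (14 * (s + 4) * (u + 4) - 3 * (c * (6 * s * u + 8 * s + 8 * u)))
          / (35 * (s + 2) * (u + 2) * (s + 4) * (u + 4))"
        using u assms by simp
      also have "\<dots> = G s - G u"
      proof -
        have "3 * v / (5 * (v + 2)) * (1 - 3 * v / (7 * (v + 4)) * c)
            = 3 * v * (7 * (v + 4) - 3 * v * c) / (35 * ((v + 2) * (v + 4)))" if "0 < v" for v
          using that by (simp add: field_simps)
        moreover have "A / (35 * P) - B / (35 * Q) = (A * Q - B * P) / (35 * (P * Q))"
          if "0 < P" "0 < Q" for A B P Q :: real using that by (simp add: field_simps)
        ultimately have "G s - G u = (3 * s * (7 * (s + 4) - 3 * s * c) * ((u + 2) * (u + 4))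
            - 3 * u * (7 * (u + 4) - 3 * u * c) * ((s + 2) * (s + 4)))
            / (35 * (((s + 2) * (s + 4)) * ((u + 2) * (u + 4))))"
          using u(1) \<open>2 < s\<close> by (simp add: G_def)
        also have "3 * s * (7 * (s + 4) - 3 * s * c) * ((u + 2) * (u + 4))
            - 3 * u * (7 * (u + 4) - 3 * u * c) * ((s + 2) * (s + 4))
            = 3 * (s - u) * (14 * (s + 4) * (u + 4) - 3 * (c * (6 * s * u + 8 * s + 8 * u)))"
          by algebra
        finally show ?thesis by (simp only: mult_ac)
      qed
      finally show ?thesis by simp
    qed
    \<comment> \<open>At \<open>u\<close> the coefficient of t^2 before the correction is (t^2 - 1)
      / (2 t^2), and 1 - t + (t^2 - 1) / 2 = (t - 1)^2 / 2. Hence (t - 1)^2 splits off and only the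
      sign of the cofactor remains.\<close>
    have "0 < 1 - t + t\<^sup>2 * G u"
    proof -
      have "0 < (7 * (7 * t\<^sup>2 + 5) - 15 * (t + 1)\<^sup>2 * c) * (6 * (4 * t\<^sup>2 + 5))"
      proof -
        have "0 < 5184 + 1752 * a - 900 * a\<^sup>2 - 1338 * a ^ 3 + 549 * a ^ 4 + 456 * a ^ 5 + 237 * a ^ 6"
          using a a2 zero_le_power[OF a(1), of 4] zero_le_power[OF a(1), of 5] zero_le_power[OF a(1), of 6]
          by linarith
        also have "\<dots> = 4 * (7 * (7 * t\<^sup>2 + 5) * (6 * (4 * t\<^sup>2 + 5)) - 15 * (t + 1)\<^sup>2 *
            (t * (6 * (4 * t\<^sup>2 + 5) - 79 / 100 * (5 * (t\<^sup>2 - 1)) * t)))"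
          unfolding ta by (simp add: eval_nat_numeral algebra_simps)
        also have "\<dots> = 4 * ((7 * (7 * t\<^sup>2 + 5) - 15 * (t + 1)\<^sup>2 * c) * (6 * (4 * t\<^sup>2 + 5)))"
          unfolding c_eq[symmetric] by (simp add: algebra_simps)
        finally show ?thesis by (rule zero_less_mult_pos) simp
      qed
      hence *: "0 < 7 * (7 * t\<^sup>2 + 5) - 15 * (t + 1)\<^sup>2 * c" using t_pos(3) zero_less_mult_pos2 by fastforce
      have "3 * u / (5 * (u + 2)) = (t\<^sup>2 - 1) / (2 * t\<^sup>2)"
        "3 * u / (7 * (u + 4)) = 15 * (t\<^sup>2 - 1) / (7 * (7 * t\<^sup>2 + 5))"
      proof -
        have e: "3 * (10 * X / D) / (5 * (12 * Y / D)) = X / (2 * Y)"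
          "3 * (10 * X / D) / (7 * (2 * Y / D)) = 15 * X / (7 * Y)" if "0 < D" "0 < Y" for X Y D :: real
          using that by (simp_all add: field_simps)
        show "3 * u / (5 * (u + 2)) = (t\<^sup>2 - 1) / (2 * t\<^sup>2)"
          unfolding u_add unfolding u_def by (rule e(1)[OF tp]) (use \<open>0 < t\<close> in simp)
        show "3 * u / (7 * (u + 4)) = 15 * (t\<^sup>2 - 1) / (7 * (7 * t\<^sup>2 + 5))"
          unfolding u_add unfolding u_def by (rule e(2)[OF tp t_pos(2)])
      qed
      hence "t\<^sup>2 * G u = (t\<^sup>2 - 1) / 2 * (1 - 15 * (t\<^sup>2 - 1) / (7 * (7 * t\<^sup>2 + 5)) * c)"
        using \<open>0 < t\<close> by (simp add: G_def)
      also have "\<dots> = ((t\<^sup>2 - 1) * (7 * (7 * t\<^sup>2 + 5)) - 15 * (t\<^sup>2 - 1)\<^sup>2 * c) / (14 * (7 * t\<^sup>2 + 5))"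
        using t_pos by (simp add: field_simps power2_eq_square)
      finally have "1 - t + t\<^sup>2 * G u = ((1 - t) * (14 * (7 * t\<^sup>2 + 5))
          + ((t\<^sup>2 - 1) * (7 * (7 * t\<^sup>2 + 5)) - 15 * (t\<^sup>2 - 1)\<^sup>2 * c)) / (14 * (7 * t\<^sup>2 + 5))"
        using t_pos by (simp add: add_divide_distrib)
      also have "(1 - t) * (14 * (7 * t\<^sup>2 + 5)) + ((t\<^sup>2 - 1) * (7 * (7 * t\<^sup>2 + 5)) - 15 * (t\<^sup>2 - 1)\<^sup>2 * c)
          = (t - 1)\<^sup>2 * (7 * (7 * t\<^sup>2 + 5) - 15 * (t + 1)\<^sup>2 * c)"
        by (simp add: algebra_simps power2_eq_square)
      finally have "1 - t + t\<^sup>2 * G u =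
          (t - 1)\<^sup>2 * (7 * (7 * t\<^sup>2 + 5) - 15 * (t + 1)\<^sup>2 * c) / (14 * (7 * t\<^sup>2 + 5))" .
      thus ?thesis using * False t_pos by simp
    qed
    also have "\<dots> \<le> 1 - t + t\<^sup>2 * G s" using \<open>G u \<le> G s\<close> by (simp add: mult_left_mono)
    also have "\<dots> = 1 - t + r 2 * t\<^sup>2 * (1 - r 3 * c)" by (simp add: G_def r mult_ac)
    also have "\<dots> \<le> 1 - t + r 2 * t\<^sup>2 * (1 - r 3 * t * Y)" using \<open>r 2 * t\<^sup>2 * (1 - r 3 * c) \<le> _\<close> by simp
    finally show ?thesis .
  qed
  ultimately show ?thesis by simp
qed

section \<open>The Struve series at \<open>2 \<pi>\<close>\<close>

text \<open>In Pochhammer notation this is \<open>1 / (4 ^ m (3/2)_m (\<nu> + 3/2)_m)\<close>.\<close>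

primrec struve_coeff :: "real \<Rightarrow> nat \<Rightarrow> real" where
  "struve_coeff \<nu> 0 = 1"
| "struve_coeff \<nu> (Suc m) = struve_coeff \<nu> m / ((2 * real m + 3) * (2 * real m + 2 * \<nu> + 3))"

text \<open>Termwise integration of the Taylor series of sin(y) / y at y = x sqrt u: the moments of
  the weight are Beta values, and dominated convergence gives both integrability and the
  sum.\<close>

lemma sin_over_self_sums_Beta:
  fixes x p :: real
  assumes "0 < x" "- 1 < p"
  defines "S \<equiv> (\<lambda>u. sin (x * sqrt u) / (x * sqrt u) * (1 - u) powr p)"
  shows "S integrable_on {0<..<1}"
    and "(\<lambda>m. (- 1) ^ m / fact (2 * m + 1) * x ^ (2 * m) * Beta (real m + 1) (p + 1)) sums
      integral {0<..<1} S"
proof -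
  define e where "e m = (- 1) ^ m / fact (2 * m + 1) * x ^ (2 * m)" for m
  define f where "f k u = (\<Sum>m<k. e m * (u ^ m * (1 - u) powr p))" for k u
  have mom: "((\<lambda>u. u ^ m * (1 - u) powr p) has_integral Beta (real m + 1) (p + 1)) {0<..<1}" for m
  proof -
    have "((\<lambda>u. u powr (real m + 1 - 1) * (1 - u) powr (p + 1 - 1)) has_integral
        Beta (real m + 1) (p + 1)) {0<..<1}"
      using has_integral_Beta_real[of "real m + 1" "p + 1"] assms
      by (simp add: has_integral_Icc_iff_Ioo)
    thus ?thesis by (rule has_integral_eq[rotated]) (simp add: powr_realpow)
  qed
  have f_int: "(f k has_integral (\<Sum>m<k. e m * Beta (real m + 1) (p + 1))) {0<..<1}" for k
    unfolding f_def by (intro has_integral_sum has_integral_mult_right mom) simp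
  have h: "(\<lambda>u. exp (x\<^sup>2) * (1 - u) powr p) integrable_on {0<..<1}"
    using integrable_on_cmult_left[OF has_integral_integrable[OF mom[of 0]], of "exp (x\<^sup>2)"] by simp
  have bound: "norm (f k u) \<le> exp (x\<^sup>2) * (1 - u) powr p" if "u \<in> {0<..<1}" for k u
  proof -
    have "norm (f k u) = \<bar>\<Sum>m<k. e m * u ^ m\<bar> * (1 - u) powr p"
      by (simp add: f_def sum_distrib_right[symmetric] abs_mult mult.assoc[symmetric])
    also have "\<bar>\<Sum>m<k. e m * u ^ m\<bar> \<le> (\<Sum>m<k. \<bar>e m * u ^ m\<bar>)" by (rule sum_abs)
    \<comment> \<open>Since (2m + 1)! \<ge> m! and u < 1, the exponential series in x^2 bounds all
      partial sums uniformly in \<open>k\<close> and \<open>u\<close>.\<close>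
    also have "\<dots> \<le> (\<Sum>m<k. inverse (fact m) * (x\<^sup>2) ^ m)"
    proof (rule sum_mono)
      fix m
      have "\<bar>e m * u ^ m\<bar> = inverse (fact (2 * m + 1)) * (x\<^sup>2) ^ m * u ^ m"
        using that by (simp add: e_def abs_mult power_mult divide_inverse del: fact_Suc)
      also have "\<dots> \<le> inverse (fact m) * (x\<^sup>2) ^ m * 1"
        using that fact_mono[of m "2 * m + 1", where 'a = real]
        by (intro mult_mono power_le_one le_imp_inverse_le) auto
      finally show "\<bar>e m * u ^ m\<bar> \<le> inverse (fact m) * (x\<^sup>2) ^ m" by simp
    qed
    also have "\<dots> \<le> (\<Sum>m. inverse (fact m) * (x\<^sup>2) ^ m)"
      by (rule sum_le_suminf[OF summable_exp]) auto
    also have "\<dots> = exp (x\<^sup>2)" by (simp add: exp_def)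
    finally show ?thesis by (simp add: mult_right_mono)
  qed
  have lim: "(\<lambda>k. f k u) \<longlonglongrightarrow> S u" if "u \<in> {0<..<1}" for u
  proof -
    have "(\<lambda>m. (- 1) ^ m / fact (2 * m + 1) * (x * sqrt u) ^ (2 * m + 1) / (x * sqrt u) * (1 - u) powr p)
        sums (S u)"
      unfolding S_def by (intro sums_mult2 sums_divide sin_paired)
    moreover have "(- 1) ^ m / fact (2 * m + 1) * (x * sqrt u) ^ (2 * m + 1) / (x * sqrt u) * (1 - u) powr p
        = e m * (u ^ m * (1 - u) powr p)" for m
    proof -
      have "(x * sqrt u) ^ (2 * m + 1) / (x * sqrt u) = x ^ (2 * m) * u ^ m"
        using that \<open>0 < x\<close> by (simp add: power_mult power_mult_distrib)
      thus ?thesis unfolding e_def by (metis (no_types, lifting) mult.assoc times_divide_eq_right)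
    qed
    ultimately show ?thesis unfolding sums_def f_def by (simp only:)
  qed
  note dc = dominated_convergence[OF has_integral_integrable[OF f_int] h bound lim]
  show "S integrable_on {0<..<1}" by (rule dc(1))
  have "(\<lambda>m. e m * Beta (real m + 1) (p + 1)) sums integral {0<..<1} S"
    using dc(2) integral_unique[OF f_int] by (simp add: sums_def)
  thus "(\<lambda>m. (- 1) ^ m / fact (2 * m + 1) * x ^ (2 * m) * Beta (real m + 1) (p + 1)) sums
      integral {0<..<1} S" by (simp add: e_def)
qed

text \<open>Identifies the normalised Struve series with the integral above for p = \<nu> - 1/2. The
  step of the induction is the recurrence of Beta in its first argument; the base is q Beta(1, q) =
  1.\<close>

lemma struve_coeff_Beta:
  assumes "- 1 / 2 < \<nu>"
  shows "(\<nu> + 1 / 2) * (1 / fact (2 * m + 1) * Beta (real m + 1) (\<nu> + 1 / 2)) = struve_coeff \<nu> m"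
proof (induction m)
  case 0
  have "\<nu> + 1 / 2 \<notin> \<int>\<^sub>\<le>\<^sub>0" using assms by (auto elim!: nonpos_Ints_cases)
  hence "(\<nu> + 1 / 2) * Beta 1 (\<nu> + 1 / 2) = 1"
    using Gamma_plus1[of "\<nu> + 1 / 2"] Gamma_eq_zero_iff[of "\<nu> + 1 / 2"] assms
    by (simp add: Beta_def add.commute)
  thus ?case by simp
next
  case (Suc m)
  have "real m + 1 \<notin> \<int>\<^sub>\<le>\<^sub>0" by (auto elim!: nonpos_Ints_cases)
  from Beta_plus1_left[OF this, of "\<nu> + 1 / 2"]
  have "Beta (real (Suc m) + 1) (\<nu> + 1 / 2) =
      (2 * real m + 2) / (2 * real m + 2 * \<nu> + 3) * Beta (real m + 1) (\<nu> + 1 / 2)"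
    using assms by (simp add: field_simps)
  moreover have "fact (2 * Suc m + 1) = (2 * real m + 3) * (2 * real m + 2) * fact (2 * m + 1)"
    by (simp add: algebra_simps)
  moreover have "x * (1 / (a * b * F) * (b / d * B)) = x * (1 / F * B) / (a * d)"
    if "0 < a" "0 < b" "0 < d" "0 < F" for x a b d F B :: real
    using that by (simp add: field_simps)
  ultimately have "(\<nu> + 1 / 2) * (1 / fact (2 * Suc m + 1) * Beta (real (Suc m) + 1) (\<nu> + 1 / 2))
     = ((\<nu> + 1 / 2) * (1 / fact (2 * m + 1) * Beta (real m + 1) (\<nu> + 1 / 2))) /
      ((2 * real m + 3) * (2 * real m + 2 * \<nu> + 3))"
    using assms by (simp del: fact_Suc)
  thus ?case unfolding Suc.IH by simp
qed

lemma struve_series_2pi_nonpos: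
  assumes "\<bar>\<nu>\<bar> < 1 / 2"
  shows "(\<Sum>m. (- 1) ^ m * struve_coeff \<nu> m * ((2 * pi)\<^sup>2) ^ m) \<le> 0"
proof -
  define S where "S u = sin (2 * pi * sqrt u) / (2 * pi * sqrt u)" for u
  define p where "p = \<nu> - 1 / 2"
  have p: "- 1 < p" "p < 0" "p + 1 = \<nu> + 1 / 2" using assms by (auto simp: p_def)
  note int = sin_over_self_sums_Beta[of "2 * pi" p, folded S_def]
  note int0 = sin_over_self_sums_Beta[of "2 * pi" 0, folded S_def]
  have S_int: "S integrable_on {0<..<1}"
    by (rule integrable_eq[OF int0(1)]) auto
  \<comment> \<open>For weight 1 the integral is 2 (1 - cos x) / x^2 at x = 2 pi; the series is the
    cosine series with its first term removed and the index shifted.\<close>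
  have "integral {0<..<1} (\<lambda>u. S u * (1 - u) powr 0) = 0"
  proof -
    have "(\<lambda>n. (- 1) ^ n / (fact (2 * n)) * (2 * pi) ^ (2 * n)) sums (0 + 1)"
      using cos_paired[of "2 * pi"] by simp
    hence "(\<lambda>n. (- 1) ^ Suc n / (fact (2 * Suc n)) * (2 * pi) ^ (2 * Suc n)) sums 0"
      by (subst sums_Suc_iff) simp
    from sums_mult[OF this, of "- 2 / (2 * pi)\<^sup>2"]
    have "(\<lambda>n. - 2 / (2 * pi)\<^sup>2 * ((- 1) ^ Suc n / (fact (2 * Suc n)) * (2 * pi) ^ (2 * Suc n))) sums 0"
      by simp
    moreover have "- 2 / (2 * pi)\<^sup>2 * ((- 1) ^ Suc n / (fact (2 * Suc n)) * (2 * pi) ^ (2 * Suc n))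
        = (- 1) ^ n / fact (2 * n + 1) * (2 * pi) ^ (2 * n) * Beta (real n + 1) (0 + 1)" for n
    proof -
      have "Beta (real n + 1) (0 + 1) = 1 / (real n + 1)"
      proof -
        have "real n + 1 \<notin> \<int>\<^sub>\<le>\<^sub>0" by (auto elim!: nonpos_Ints_cases)
        from Gamma_plus1[OF this] show ?thesis
          using Gamma_eq_zero_iff[of "real n + 1"] \<open>real n + 1 \<notin> _\<close>
          by (simp add: Beta_def add_ac)
      qed
      moreover have "fact (2 * Suc n) = 2 * (real n + 1) * fact (2 * n + 1)" by (simp add: algebra_simps)
      moreover have "(2 * pi) ^ (2 * Suc n) = (2 * pi)\<^sup>2 * (2 * pi) ^ (2 * n)"
        by (simp add: power_add[symmetric])
      moreover have "- 2 / Q * ((- 1) ^ Suc n / (2 * N * F) * (Q * P)) = (- 1) ^ n / F * P * (1 / N)"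
        if "0 < Q" "0 < N" "0 < F" for Q N F P :: real using that by (simp add: field_simps)
      from this[of "(2 * pi)\<^sup>2" "real n + 1" "fact (2 * n + 1)" "(2 * pi) ^ (2 * n)"]
      have "- 2 / (2 * pi)\<^sup>2 * ((- 1) ^ Suc n / (2 * (real n + 1) * fact (2 * n + 1)) *
          ((2 * pi)\<^sup>2 * (2 * pi) ^ (2 * n)))
        = (- 1) ^ n / fact (2 * n + 1) * (2 * pi) ^ (2 * n) * (1 / (real n + 1))"
        by (simp del: fact_Suc)
      ultimately show ?thesis by (simp only:)
    qed
    ultimately show ?thesis using int0(2) sums_unique2 by fastforce
  qed
  also have "integral {0<..<1} (\<lambda>u. S u * (1 - u) powr 0) = integral {0<..<1} S"
    by (rule integral_cong) auto
  finally have S0: "integral {0<..<1} S = 0" .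
  \<comment> \<open>\<open>S\<close> changes sign at u = 1/4, where the increasing weight equals
    \<open>(3 / 4) powr p\<close>. Freezing the weight at this value can only raise the integrand on
    either side.\<close>
  have "integral {0<..<1} (\<lambda>u. S u * (1 - u) powr p) \<le> integral {0<..<1} (\<lambda>u. S u * (3 / 4) powr p)"
  proof (rule integral_le)
    show "(\<lambda>u. S u * (3 / 4) powr p) integrable_on {0<..<1}"
      using integrable_on_cmult_right[OF S_int, of "(3 / 4) powr p"] by simp
    show "S u * (1 - u) powr p \<le> S u * (3 / 4) powr p" if "u \<in> {0<..<1}" for u
    proof (cases "u \<le> 1 / 4")
      case True
      hence "sqrt u \<le> sqrt ((1 / 2)\<^sup>2)" by (intro real_sqrt_le_mono) (simp add: power_divide)
      hence "0 \<le> sin (2 * pi * sqrt u)" using that by (intro sin_ge_zero) auto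
      hence "0 \<le> S u" using that by (simp add: S_def)
      moreover have "(1 - u) powr p \<le> (3 / 4) powr p"
        using True p by (intro powr_mono2') auto
      ultimately show ?thesis by (intro mult_left_mono)
    next
      case False
      hence "sqrt ((1 / 2)\<^sup>2) \<le> sqrt u" by (intro real_sqrt_le_mono) (simp add: power_divide)
      hence "1 / 2 \<le> sqrt u" by (simp only: real_sqrt_abs)
      hence "0 \<le> sin (2 * pi * sqrt u - pi)" using that by (intro sin_ge_zero) (auto simp: field_simps)
      hence "sin (2 * pi * sqrt u) \<le> 0" by (simp add: sin_diff)
      hence "S u \<le> 0" using that by (simp add: S_def divide_nonpos_pos)
      moreover have "(3 / 4) powr p \<le> (1 - u) powr p"
        using False that p by (intro powr_mono2') auto
      ultimately show ?thesis by (intro mult_left_mono_neg)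
    qed
  qed (use int(1) p in simp)
  also have "\<dots> = 0" using S0 by simp
  finally have le0: "integral {0<..<1} (\<lambda>u. S u * (1 - u) powr p) \<le> 0" .
  have "(\<lambda>m. (\<nu> + 1 / 2) * ((- 1) ^ m / fact (2 * m + 1) * (2 * pi) ^ (2 * m) * Beta (real m + 1) (\<nu> + 1 / 2)))
      sums ((\<nu> + 1 / 2) * integral {0<..<1} (\<lambda>u. S u * (1 - u) powr p))"
    using int(2) p by (intro sums_mult) simp
  also have "(\<lambda>m. (\<nu> + 1 / 2) * ((- 1) ^ m / fact (2 * m + 1) * (2 * pi) ^ (2 * m) * Beta (real m + 1) (\<nu> + 1 / 2)))
      = (\<lambda>m. (- 1) ^ m * struve_coeff \<nu> m * ((2 * pi)\<^sup>2) ^ m)"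
  proof -
    have "- 1 / 2 < \<nu>" using assms by auto
    moreover have "a * (s / F * P * B) = s * (a * (1 / F * B)) * P" for a s F P B :: real by simp
    ultimately show ?thesis by (simp only: struve_coeff_Beta[symmetric] power_mult)
  qed
  finally show ?thesis
    using le0 assms by (simp add: sums_iff mult_nonneg_nonpos)
qed

section \<open>First zeros of the Struve function and its derivatives\<close>

lemma struve_coeff_pos:
  assumes "- 3 / 2 < \<nu>"
  shows "0 < struve_coeff \<nu> m"
  using assms by (induction m) auto

lemma summable_struve_coeff:
  assumes "- 3 / 2 < \<nu>"
  shows "summable (\<lambda>m. (- 1) ^ m * struve_coeff \<nu> m * y ^ m)"
proof (rule summable_ratio_test)
  fix m assume m: "nat \<lceil>\<bar>y\<bar>\<rceil> + 1 \<le> m"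
  \<comment> \<open>The first factor of the denominator then exceeds 2 |y|, and
    \<open>1 \<le> real m\<close> keeps the second at least 1, so the ratio is at most 1/2.\<close>
  hence "\<bar>y\<bar> \<le> real m" "1 \<le> real m" by linarith+
  hence "\<bar>y\<bar> * 2 \<le> (2 * real m + 3) * 1" by simp
  also have "\<dots> \<le> (2 * real m + 3) * (2 * real m + 2 * \<nu> + 3)"
    using assms \<open>1 \<le> real m\<close> by (intro mult_left_mono) auto
  finally have "\<bar>y\<bar> / ((2 * real m + 3) * (2 * real m + 2 * \<nu> + 3)) \<le> 1 / 2"
    using assms by (simp add: divide_le_eq)
  hence "\<bar>y\<bar> / ((2 * real m + 3) * (2 * real m + 2 * \<nu> + 3)) * (struve_coeff \<nu> m * \<bar>y\<bar> ^ m)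
      \<le> 1 / 2 * (struve_coeff \<nu> m * \<bar>y\<bar> ^ m)"
    using struve_coeff_pos[OF assms, of m] by (intro mult_right_mono) auto
  thus "norm ((- 1) ^ Suc m * struve_coeff \<nu> (Suc m) * y ^ Suc m)
      \<le> 1 / 2 * norm ((- 1) ^ m * struve_coeff \<nu> m * y ^ m)"
    using struve_coeff_pos[OF assms, of m] assms
    by (simp add: abs_mult power_abs mult_ac)
qed simp

text \<open>Both sides obey the same recurrence by Gamma(x + 1) = x Gamma(x); the power of 1/2
  clears the half-integers.\<close>

lemma struve_coeff_Gamma:
  assumes "- 3 / 2 < \<nu>"
  shows "1 / (Gamma (real m + 3 / 2) * Gamma (real m + \<nu> + 3 / 2)) * (1 / 2) ^ (2 * m)
    = struve_coeff \<nu> m / (Gamma (3 / 2) * Gamma (\<nu> + 3 / 2))"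
proof (induction m)
  case (Suc m)
  have "real m + 3 / 2 \<notin> \<int>\<^sub>\<le>\<^sub>0" "real m + \<nu> + 3 / 2 \<notin> \<int>\<^sub>\<le>\<^sub>0"
    using assms by (auto elim!: nonpos_Ints_cases)
  from this[THEN Gamma_plus1]
  have "Gamma (real (Suc m) + 3 / 2) = (real m + 3 / 2) * Gamma (real m + 3 / 2)"
    "Gamma (real (Suc m) + \<nu> + 3 / 2) = (real m + \<nu> + 3 / 2) * Gamma (real m + \<nu> + 3 / 2)"
    by (simp_all add: add_ac)
  hence "1 / (Gamma (real (Suc m) + 3 / 2) * Gamma (real (Suc m) + \<nu> + 3 / 2)) * (1 / 2) ^ (2 * Suc m)
      = (1 / (Gamma (real m + 3 / 2) * Gamma (real m + \<nu> + 3 / 2)) * (1 / 2) ^ (2 * m))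
        * (1 / ((real m + 3 / 2) * (real m + \<nu> + 3 / 2)) * (1 / 4))"
    by (simp add: power2_eq_square)
  also have "1 / ((real m + 3 / 2) * (real m + \<nu> + 3 / 2)) * (1 / 4)
      = 1 / ((2 * real m + 3) * (2 * real m + 2 * \<nu> + 3))"
    using assms by (simp add: field_simps)
  finally show ?case unfolding Suc.IH by simp
qed simp

lemma struve_H_eq_frobenius_series:
  assumes "- 3 / 2 < \<nu>" "0 \<le> x"
  shows "struve_H \<nu> x = (1 / 2) powr (\<nu> + 1) / (Gamma (3 / 2) * Gamma (\<nu> + 3 / 2))
    * frobenius_series (\<nu> + 1) (\<lambda>m. (- 1) ^ m * struve_coeff \<nu> m) x"
proof -
  define C where "C = 1 / (Gamma (3 / 2) * Gamma (\<nu> + 3 / 2))"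
  have "(- 1) ^ m / (Gamma (real m + 3 / 2) * Gamma (real m + \<nu> + 3 / 2)) * (x / 2) ^ (2 * m)
      = C * ((- 1) ^ m * struve_coeff \<nu> m * (x\<^sup>2) ^ m)" for m
  proof -
    have "(- 1) ^ m / (Gamma (real m + 3 / 2) * Gamma (real m + \<nu> + 3 / 2)) * (x / 2) ^ (2 * m)
      = (- 1) ^ m * x ^ (2 * m) *
        (1 / (Gamma (real m + 3 / 2) * Gamma (real m + \<nu> + 3 / 2)) * (1 / 2) ^ (2 * m))"
      by (simp add: power_divide)
    thus ?thesis unfolding struve_coeff_Gamma[OF assms(1)] by (simp add: C_def power_mult)
  qed
  moreover have "(x / 2) powr (\<nu> + 1) = (1 / 2) powr (\<nu> + 1) * x powr (\<nu> + 1)"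
    using powr_mult[of "1 / 2" x "\<nu> + 1"] assms by simp
  ultimately show ?thesis
    using suminf_mult[OF summable_struve_coeff[OF assms(1), of "x\<^sup>2"], of C]
    by (simp add: struve_H_def frobenius_series_def C_def)
qed

text \<open>Agreement on the open half-line is enough, because derivatives are local. So the rule
  also applies to \<open>deriv (struve_H \<nu>)\<close>, which is known as a series only for
  positive arguments.\<close>

lemma deriv_frobenius_series:
  assumes c: "\<And>y. summable (\<lambda>m. c m * y ^ m)"
    and f: "\<And>x. 0 < x \<Longrightarrow> f x = K * frobenius_series p c x" and "0 < x"
  shows "deriv f x = K * frobenius_series (p - 1) (\<lambda>m. (2 * real m + p) * c m) x"
proof (rule DERIV_imp_deriv)
  have "((\<lambda>x. K * frobenius_series p c x) has_real_derivative
      K * frobenius_series (p - 1) (\<lambda>m. (2 * real m + p) * c m) x) (at x)"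
    by (intro DERIV_cmult frobenius_series_has_derivative c \<open>0 < x\<close>)
  thus "(f has_real_derivative K * frobenius_series (p - 1) (\<lambda>m. (2 * real m + p) * c m) x) (at x)"
    by (rule has_field_derivative_transform_within_open[of _ _ _ "{0<..}"])
      (use f \<open>0 < x\<close> in auto)
qed

section \<open>Positivity of the series and bounds for first zeros\<close>

lemma frobenius_series_cmult:
  assumes "\<And>y. summable (\<lambda>m. c m * y ^ m)"
  shows "frobenius_series p (\<lambda>m. a * c m) x = a * frobenius_series p c x"
  using suminf_mult[OF assms[of "x\<^sup>2"], of a] by (simp add: frobenius_series_def mult_ac)

text \<open>Positivity gives the second bound; the first follows from it since 1 / b1^2 \<le> 1 /
  (b1^2 - 2 b2). Formally, b1 and b1^2 - 2 b2 are the sums of 1/z and 1/z^2 over the zeros z of the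
  series.\<close>

lemma first_pos_zero_bounds:
  fixes b1 b2 :: real
  assumes "0 < b1" "0 < b2" "0 < b1\<^sup>2 - 2 * b2" "0 < C"
    and c: "\<And>y. summable (\<lambda>m. c m * y ^ m)"
    and f: "\<And>x. 0 < x \<Longrightarrow> f x = C * frobenius_series p c x"
    and pos: "\<And>z. 0 < z \<Longrightarrow> (b1\<^sup>2 - 2 * b2) * z\<^sup>2 \<le> 1 \<Longrightarrow> 0 < (\<Sum>m. c m * z ^ m)"
    and zero: "0 < y" "f y = 0"
  shows "sqrt (1 / b1) < first_pos_zero f"
    and "sqrt (1 / (b1\<^sup>2 - 2 * b2)) < (first_pos_zero f)\<^sup>2"
proof -
  define S where "S = sqrt (1 / (b1\<^sup>2 - 2 * b2))"
  have S: "0 < S" "(b1\<^sup>2 - 2 * b2) * S\<^sup>2 = 1" using assms(3) by (simp_all add: S_def)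
  have "isCont (frobenius_series p c) x" if "0 < x" for x
    by (rule DERIV_isCont[OF frobenius_series_has_derivative]) (use c that in auto)
  hence "continuous_on {0<..} (\<lambda>x. C * frobenius_series p c x)"
    by (intro continuous_intros continuous_at_imp_continuous_on) auto
  hence cont: "continuous_on {0<..} f"
    by (rule continuous_on_eq) (use f in auto)
  have "sqrt S < first_pos_zero f"
  proof (rule first_pos_zero_gt[OF cont])
    fix x assume x: "0 < x" "x \<le> sqrt S"
    hence "x\<^sup>2 \<le> (sqrt S)\<^sup>2" by (intro power_mono) auto
    hence "(x\<^sup>2)\<^sup>2 \<le> S\<^sup>2" using S by (intro power_mono) auto
    hence "(b1\<^sup>2 - 2 * b2) * (x\<^sup>2)\<^sup>2 \<le> 1"
      using mult_left_mono[of "(x\<^sup>2)\<^sup>2" "S\<^sup>2" "b1\<^sup>2 - 2 * b2"] S assms(3) by simp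
    hence "0 < (\<Sum>m. c m * (x\<^sup>2) ^ m)" using x by (intro pos) auto
    thus "0 < f x" using f[OF x(1)] x \<open>0 < C\<close> by (simp add: frobenius_series_def)
  qed (use S zero in auto)
  have "1 / b1\<^sup>2 \<le> 1 / (b1\<^sup>2 - 2 * b2)" using assms(1-3) by (intro frac_le) auto
  hence "1 / b1 \<le> S" unfolding S_def by (intro real_le_rsqrt) (simp add: power_divide)
  hence "sqrt (1 / b1) \<le> sqrt S" by (rule real_sqrt_le_mono)
  thus "sqrt (1 / b1) < first_pos_zero f" using \<open>sqrt S < _\<close> by (rule le_less_trans)
  have "(sqrt S)\<^sup>2 < (first_pos_zero f)\<^sup>2"
    using \<open>sqrt S < _\<close> S by (intro power_strict_mono) auto
  thus "sqrt (1 / (b1\<^sup>2 - 2 * b2)) < (first_pos_zero f)\<^sup>2"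
    using S by (simp add: S_def[symmetric])
qed

text \<open>Serves the derivatives, whose coefficients are Struve coefficients times weights. The
  first four terms form the cubic of \<open>cubic_pos\<close>; the later ones decrease because the
  weights grow at most by the factor \<open>w 1\<close>.\<close>

lemma weighted_struve_series_pos:
  fixes w :: "nat \<Rightarrow> real" and \<nu> z :: real
  defines "b \<equiv> (\<lambda>m. w m * struve_coeff \<nu> m)"
  assumes "\<bar>\<nu>\<bar> < 1 / 2" and w0: "w 0 = 1" and wpos: "\<And>m. 0 < w m"
    and wle: "\<And>m. w (Suc m) \<le> w 1 * w m"
    and sm: "summable (\<lambda>m. (- 1) ^ m * b m * z ^ m)"
    and b2: "b 2 \<le> 5 / 18 * (b 1)\<^sup>2" and b3: "b 1 * b 3 \<le> 47 / 100 * (b 2)\<^sup>2"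
    and z: "0 < z" "((b 1)\<^sup>2 - 2 * b 2) * z\<^sup>2 \<le> 1"
  shows "0 < (\<Sum>m. (- 1) ^ m * b m * z ^ m)"
proof -
  have coeff_pos: "0 < struve_coeff \<nu> m" for m
    by (rule struve_coeff_pos) (use assms(2) in auto)
  have bpos: "0 < b m" for m
    using coeff_pos[of m] wpos[of m] by (simp add: b_def)
  define t where "t = b 1 * z"
  have "4 / 9 * t\<^sup>2 \<le> ((b 1)\<^sup>2 - 2 * b 2) * z\<^sup>2"
    unfolding t_def power_mult_distrib mult.assoc[symmetric]
    by (intro mult_right_mono) (use b2 in auto)
  hence "t\<^sup>2 \<le> 9 / 4" using z(2) by linarith
  hence "t\<^sup>2 \<le> (3 / 2)\<^sup>2" by (simp add: power_divide)
  hence t: "t \<le> 3 / 2" by (rule power2_le_imp_le) simp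
  have "0 < 1 - t + b 2 / (b 1)\<^sup>2 * t\<^sup>2 - b 3 / (b 1) ^ 3 * t ^ 3"
  proof (rule cubic_pos)
    have "b 3 * (b 1 * b 1 ^ 3) \<le> (47 / 100 * (b 2)\<^sup>2) * b 1 ^ 3"
      using mult_right_mono[OF b3, of "b 1 ^ 3"] bpos[of 1] by (simp add: mult_ac)
    thus "b 3 / b 1 ^ 3 \<le> 47 / 100 * (b 2 / (b 1)\<^sup>2)\<^sup>2"
      using bpos[of 1] by (simp add: field_simps eval_nat_numeral)
    show "(1 - 2 * (b 2 / (b 1)\<^sup>2)) * t\<^sup>2 \<le> 1"
    proof -
      have "(1 - 2 * (b 2 / (b 1)\<^sup>2)) * (b 1)\<^sup>2 = (b 1)\<^sup>2 - 2 * b 2"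
        using bpos[of 1] by (simp add: left_diff_distrib)
      moreover have "t\<^sup>2 = (b 1)\<^sup>2 * z\<^sup>2" by (simp add: t_def power_mult_distrib)
      ultimately show ?thesis using z(2) by (simp only: mult.assoc[symmetric])
    qed
  qed (use bpos[of 1] bpos[of 2] z b2 in \<open>auto simp: t_def divide_le_eq\<close>)
  also have "\<dots> = (\<Sum>m<4. (- 1) ^ m * (b m * z ^ m))"
  proof -
    have e: "b 2 / (b 1)\<^sup>2 * t\<^sup>2 = b 2 * z\<^sup>2" "b 3 / b 1 ^ 3 * t ^ 3 = b 3 * z ^ 3"
      using bpos[of 1] by (simp_all add: t_def power_mult_distrib)
    have "b 0 = 1" using w0 by (simp add: b_def)
    thus ?thesis unfolding e by (simp add: t_def eval_nat_numeral)
  qed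
  also have "\<dots> \<le> (\<Sum>m. (- 1) ^ m * (b m * z ^ m))"
  proof (rule alternating_partial_sum_le)
    fix m :: nat assume "4 \<le> m"
    \<comment> \<open>The extra factor \<open>b 1\<close> makes t = b1 z \<le> 3/2 available, and
      the growth factor \<open>w 1\<close> is absorbed into \<open>b 1\<close> at the end.\<close>
    have "b (Suc m) * z * b 1 = w (Suc m) * struve_coeff \<nu> (Suc m) * t"
      by (simp add: b_def t_def)
    also have "\<dots> \<le> (w 1 * w m) * struve_coeff \<nu> (Suc m) * (3 / 2)"
    proof (rule mult_mono[OF mult_right_mono[OF wle less_imp_le[OF coeff_pos]] t])
      show "0 \<le> w 1 * w m * struve_coeff \<nu> (Suc m)"
        by (intro mult_nonneg_nonneg less_imp_le[OF wpos] less_imp_le[OF coeff_pos])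
      show "0 \<le> t" using bpos[of 1] z(1) by (simp add: t_def)
    qed
    also have "\<dots> = (w 1 * b m) * (3 / 2 / ((2 * real m + 3) * (2 * real m + 2 * \<nu> + 3)))"
      by (simp add: b_def)
    also have "\<dots> \<le> (w 1 * b m) * struve_coeff \<nu> 1"
    proof (rule mult_left_mono)
      have "3 / 2 * (3 * (2 * \<nu> + 3)) \<le> 11 * (2 * \<nu> + 11)" using assms(2) by simp
      also have "\<dots> \<le> (2 * real m + 3) * (2 * real m + 2 * \<nu> + 3)"
        using \<open>4 \<le> m\<close> assms(2) by (intro mult_mono) auto
      finally show "3 / 2 / ((2 * real m + 3) * (2 * real m + 2 * \<nu> + 3)) \<le> struve_coeff \<nu> 1"
        using assms(2) by (simp add: field_simps)
    qed (use wpos[of 1] bpos[of m] in simp)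
    also have "\<dots> = b m * b 1" by (simp add: b_def)
    finally have "b (Suc m) * z \<le> b m" using bpos[of 1] by simp
    thus "b (Suc m) * z ^ Suc m \<le> b m * z ^ m"
      using mult_right_mono[of "b (Suc m) * z" "b m" "z ^ m"] z(1) by (simp add: mult_ac)
  next
    show "summable (\<lambda>m. (- 1) ^ m * (b m * z ^ m))" using sm by (simp add: mult.assoc)
    show "0 \<le> b m * z ^ m" for m using z bpos[of m] by simp
  qed simp
  finally show ?thesis by (simp add: mult.assoc)
qed

text \<open>Without weights b2 / b1^2 exceeds 5/18, so the cubic criterion does not apply. Six terms
  are kept instead; in t = z / (3 s) they form the nested expression of
  \<open>quintic_pos\<close>.\<close>

lemma struve_series_pos:
  assumes "\<bar>\<nu>\<bar> < 1 / 2" and z: "0 < z"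
    "((struve_coeff \<nu> 1)\<^sup>2 - 2 * struve_coeff \<nu> 2) * z\<^sup>2 \<le> 1"
  shows "0 < (\<Sum>m. (- 1) ^ m * struve_coeff \<nu> m * z ^ m)"
proof -
  define s where "s = 2 * \<nu> + 3"
  have s: "2 < s" "s < 4" using assms by (auto simp: s_def)
  define t where "t = z / (3 * s)"
  have zt: "z = 3 * s * t" using s by (simp add: t_def)
  have bpos: "0 < struve_coeff \<nu> m" for m
    using struve_coeff_pos[of \<nu> m] assms by simp
  have t2: "(10 - s) * t\<^sup>2 \<le> 5 * (s + 2)"
  proof -
    have "(struve_coeff \<nu> 1)\<^sup>2 - 2 * struve_coeff \<nu> 2 = (10 - s) / (9 * s\<^sup>2 * (5 * (s + 2)))"
    proof -
      have "(1 / (3 * s))\<^sup>2 - 2 * (1 / (3 * s * (5 * v))) = (5 * v - 6 * s) / (9 * s\<^sup>2 * (5 * v))"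
        if "0 < v" for v using that s by (simp add: field_simps power2_eq_square)
      moreover have "struve_coeff \<nu> 1 = 1 / (3 * s)" "struve_coeff \<nu> 2 = 1 / (3 * s * (5 * (s + 2)))"
        by (simp_all add: s_def eval_nat_numeral algebra_simps)
      moreover have "0 < s + 2" "5 * (s + 2) - 6 * s = 10 - s" using s by simp_all
      ultimately show ?thesis by (simp only:)
    qed
    hence "(10 - s) / (9 * s\<^sup>2 * (5 * (s + 2))) * (9 * s\<^sup>2 * t\<^sup>2) \<le> 1"
      using z(2) by (simp add: zt power_mult_distrib)
    thus ?thesis using s by (simp add: divide_le_eq)
  qed
  have "t\<^sup>2 \<le> 3\<^sup>2"
  proof -
    have "6 * t\<^sup>2 \<le> (10 - s) * t\<^sup>2" using s by (intro mult_right_mono) auto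
    also have "\<dots> \<le> 5 * (s + 2)" by (rule t2)
    also have "\<dots> \<le> 6 * 3\<^sup>2" using s by simp
    finally show ?thesis by simp
  qed
  hence "t \<le> 3" by (rule power2_le_imp_le) simp
  \<comment> \<open>A crude bound, sufficient for the terms to decrease from index 6 on.\<close>
  hence z_le: "z \<le> 36" using s z mult_mono[of "3 * s" 12 t 3] unfolding zt by (simp add: t_def)
  have "0 < 1 - t + 3 * s / ((2 * 2 + 1) * (s + 2 * 2 - 2)) * t\<^sup>2 *
      (1 - 3 * s / ((2 * 3 + 1) * (s + 2 * 3 - 2)) * t *
      (1 - 3 * s / ((2 * 4 + 1) * (s + 2 * 4 - 2)) * t *
      (1 - 3 * s / ((2 * 5 + 1) * (s + 2 * 5 - 2)) * t)))"
  proof (rule quintic_pos)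
    show "(10 - s) * t\<^sup>2 \<le> 5 * (s + 2)" by (rule t2)
  qed (use s z in \<open>auto simp: t_def\<close>)
  also have "\<dots> = (\<Sum>m<6. (- 1) ^ m * (struve_coeff \<nu> m * z ^ m))"
  proof -
    \<comment> \<open>\<open>R m\<close> is \<open>r (m + 1)\<close> of \<open>quintic_pos\<close>:
      the index is shifted so that \<open>R m * t\<close> is the quotient of consecutive
      terms.\<close>
    define R where "R m = 3 * s / ((2 * real m + 3) * (s + 2 * real m))" for m
    have R: "R 0 = 1" "3 * s / ((2 * 2 + 1) * (s + 2 * 2 - 2)) = R 1" "3 * s / ((2 * 3 + 1) * (s + 2 * 3 - 2)) = R 2"
      "3 * s / ((2 * 4 + 1) * (s + 2 * 4 - 2)) = R 3" "3 * s / ((2 * 5 + 1) * (s + 2 * 5 - 2)) = R 4"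
      using s by (simp_all add: R_def)
    define g where "g m = struve_coeff \<nu> m * z ^ m" for m
    have g: "g 0 = 1" "g (Suc m) = R m * t * g m" for m
    proof -
      have e: "2 * real m + 2 * \<nu> + 3 = s + 2 * real m" by (simp add: s_def)
      have "R m * t = z / ((2 * real m + 3) * (s + 2 * real m))" by (simp add: zt R_def)
      thus "g (Suc m) = R m * t * g m" by (simp only: g_def struve_coeff.simps e) simp
    qed (simp add: g_def)
    show ?thesis
      unfolding R g_def[symmetric]
      by (simp add: g R(1) eval_nat_numeral) (simp add: algebra_simps)
  qed
  also have "\<dots> \<le> (\<Sum>m. (- 1) ^ m * (struve_coeff \<nu> m * z ^ m))"
  proof (rule alternating_partial_sum_le)
    fix m :: nat assume "6 \<le> m"
    have "z \<le> 12 * 3" using z_le by simp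
    also have "\<dots> \<le> (2 * real m + 3) * (2 * real m + 2 * \<nu> + 3)"
      using \<open>6 \<le> m\<close> assms(1) by (intro mult_mono) auto
    finally have "z \<le> (2 * real m + 3) * (2 * real m + 2 * \<nu> + 3)" .
    hence "struve_coeff \<nu> (Suc m) * z \<le> struve_coeff \<nu> m"
      using bpos[of m] assms(1) by (simp add: divide_le_eq mult_left_mono)
    thus "struve_coeff \<nu> (Suc m) * z ^ Suc m \<le> struve_coeff \<nu> m * z ^ m"
      using mult_right_mono[of "struve_coeff \<nu> (Suc m) * z" "struve_coeff \<nu> m" "z ^ m"] z(1)
      by (simp add: mult_ac)
  next
    show "summable (\<lambda>m. (- 1) ^ m * (struve_coeff \<nu> m * z ^ m))"
      using summable_struve_coeff[of \<nu> z] assms(1) by (simp add: mult.assoc)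
    show "0 \<le> struve_coeff \<nu> m * z ^ m" for m using z bpos[of m] by simp
  qed simp
  finally show ?thesis by (simp add: mult.assoc)
qed

text \<open>Intermediate value theorem between 1, where the series is positive, and 2 pi. Starting
  at 1 excludes the trivial zero at the origin.\<close>

lemma struve_H_zero:
  assumes "\<bar>\<nu>\<bar> < 1 / 2"
  obtains y where "0 < y" "struve_H \<nu> y = 0"
proof -
  let ?F = "frobenius_series (\<nu> + 1) (\<lambda>m. (- 1) ^ m * struve_coeff \<nu> m)"
  have \<nu>: "- 3 / 2 < \<nu>" using assms by auto
  have "((struve_coeff \<nu> 1)\<^sup>2 - 2 * struve_coeff \<nu> 2) * 1\<^sup>2 \<le> (1 / 6)\<^sup>2"
  proof -
    have "struve_coeff \<nu> 1 \<le> 1 / 6" using assms by (simp add: frac_le)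
    hence "(struve_coeff \<nu> 1)\<^sup>2 \<le> (1 / 6)\<^sup>2"
      using struve_coeff_pos[OF \<nu>, of 1] by (intro power_mono) auto
    thus ?thesis using struve_coeff_pos[OF \<nu>, of 2] unfolding power_one mult_1_right by linarith
  qed
  hence "0 < ?F 1"
    using struve_series_pos[of \<nu> 1] assms by (simp add: frobenius_series_def power_divide)
  moreover have "?F (2 * pi) \<le> 0"
    using struve_series_2pi_nonpos[OF assms] by (simp add: frobenius_series_def mult_nonneg_nonpos)
  moreover have "1 \<le> 2 * pi" using pi_gt3 by simp
  moreover have "continuous_on {1..2 * pi} ?F"
    by (rule continuous_on_subset[OF continuous_on_frobenius_series[OF summable_struve_coeff[OF \<nu>]]])
      (use assms in auto)
  ultimately obtain y where "1 \<le> y" "?F y = 0"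
    using IVT2'[of ?F "2 * pi" 0 1] by auto
  thus ?thesis using that[of y] struve_H_eq_frobenius_series[OF \<nu>, of y] by auto
qed

text \<open>Brings the second bound for b1 = a / D and b2 = c / (D E) into the form of the
  theorem.\<close>

lemma sqrt_inverse_sigma:
  fixes D E a c :: real
  assumes "0 < D" "0 < E"
  shows "sqrt (1 / ((a / D)\<^sup>2 - 2 * (c / (D * E)))) = D * sqrt (E / (a\<^sup>2 * E - 2 * c * D))"
proof -
  have "(a / D)\<^sup>2 - 2 * (c / (D * E)) = (a\<^sup>2 * E - 2 * c * D) / (D\<^sup>2 * E)"
    using assms by (simp add: field_simps power2_eq_square)
  hence "1 / ((a / D)\<^sup>2 - 2 * (c / (D * E))) = D\<^sup>2 * (E / (a\<^sup>2 * E - 2 * c * D))" by simp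
  thus ?thesis using assms by (simp only: real_sqrt_mult real_sqrt_abs abs_of_pos)
qed

text \<open>Normalising \<open>v\<close> by \<open>v 0\<close> gives b1 = v1 / D and b2 = v2 / (D
  E). The hypotheses \<open>v2\<close> and \<open>v3\<close> are b2 / b1^2 \<le> 5/18 and b1 b3 /
  b2^2 \<le> 47/100 with denominators cleared.\<close>

lemma weighted_struve_first_zero:
  fixes v :: "nat \<Rightarrow> real" and \<nu> :: real
  defines "D \<equiv> v 0 * (3 * (2 * \<nu> + 3))" and "E \<equiv> 5 * (2 * \<nu> + 5)"
  assumes "\<bar>\<nu>\<bar> < 1 / 2" and vpos: "\<And>m. 0 < v m"
    and vle: "\<And>m. v 0 * v (Suc m) \<le> v 1 * v m"
    and v2: "18 * v 2 * D \<le> 5 * (v 1)\<^sup>2 * E"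
    and v3: "100 * v 1 * v 3 * E \<le> 47 * (v 2)\<^sup>2 * (7 * (2 * \<nu> + 7))"
    and sm: "\<And>y. summable (\<lambda>m. v m * ((- 1) ^ m * struve_coeff \<nu> m) * y ^ m)"
    and f: "\<And>x. 0 < x \<Longrightarrow> f x = C * frobenius_series p (\<lambda>m. v m * ((- 1) ^ m * struve_coeff \<nu> m)) x"
    and "0 < C" "0 < y" "f y = 0"
  shows "sqrt (D / v 1) < first_pos_zero f"
    and "D * sqrt (E / ((v 1)\<^sup>2 * E - 2 * v 2 * D)) < (first_pos_zero f)\<^sup>2"
proof -
  define w where "w m = v m / v 0" for m
  define b where "b m = w m * struve_coeff \<nu> m" for m
  define F where "F = 7 * (2 * \<nu> + 7)"
  have pos: "0 < D" "0 < E" "0 < F"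
    using vpos[of 0] assms(3) by (auto simp: D_def E_def F_def)
  have b: "b 1 = v 1 / D" "b 2 = v 2 / (D * E)" "b 3 = v 3 / (D * E * F)"
    by (simp_all add: b_def w_def D_def E_def F_def eval_nat_numeral algebra_simps)
  have bpos: "0 < b 1" "0 < b 2" unfolding b by (intro divide_pos_pos mult_pos_pos vpos pos)+
  have b2: "b 2 \<le> 5 / 18 * (b 1)\<^sup>2"
  proof -
    have "18 * v 2 * D / (18 * D\<^sup>2 * E) \<le> 5 * (v 1)\<^sup>2 * E / (18 * D\<^sup>2 * E)"
      using v2 pos by (intro divide_right_mono) auto
    thus ?thesis unfolding b using pos by (simp add: power2_eq_square)
  qed
  have b3: "b 1 * b 3 \<le> 47 / 100 * (b 2)\<^sup>2"
  proof -
    have "100 * v 1 * v 3 * E / (100 * D\<^sup>2 * E\<^sup>2 * F) \<le> 47 * (v 2)\<^sup>2 * F / (100 * D\<^sup>2 * E\<^sup>2 * F)"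
      using v3 pos by (intro divide_right_mono) (auto simp: F_def)
    thus ?thesis unfolding b using pos by (simp add: power2_eq_square mult_ac)
  qed
  have sm_b: "summable (\<lambda>m. (- 1) ^ m * b m * z ^ m)" for z
    using summable_divide[OF sm[of z], of "v 0"] by (simp add: b_def w_def mult_ac)
  have fb: "f x = (C * v 0) * frobenius_series p (\<lambda>m. (- 1) ^ m * b m) x" if "0 < x" for x
    using frobenius_series_cmult[OF sm_b, of p "v 0" x] f[OF that] vpos[of 0]
    by (simp add: b_def w_def mult_ac)
  have "0 < (\<Sum>m. (- 1) ^ m * b m * z ^ m)" if "0 < z" "((b 1)\<^sup>2 - 2 * b 2) * z\<^sup>2 \<le> 1" for z
    unfolding b_def
  proof (rule weighted_struve_series_pos)
    show "w (Suc m) \<le> w 1 * w m" for m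
    proof -
      have "v 0 * v (Suc m) / (v 0 * v 0) \<le> v 1 * v m / (v 0 * v 0)"
        using vle[of m] vpos[of 0] by (intro divide_right_mono) auto
      thus ?thesis using vpos[of 0] by (simp add: w_def)
    qed
    show "w 0 = 1" "0 < w m" for m using vpos[of 0] vpos[of m] by (simp_all add: w_def)
  qed (rule assms(3) sm_b[unfolded b_def] b2[unfolded b_def] b3[unfolded b_def] that[unfolded b_def])+
  note bounds = first_pos_zero_bounds[OF bpos _ _ sm_b fb this \<open>0 < y\<close> \<open>f y = 0\<close>]
  have "0 < (b 1)\<^sup>2" using bpos by simp
  hence "0 < (b 1)\<^sup>2 - 2 * b 2" using b2 by linarith
  moreover have "0 < C * v 0" using \<open>0 < C\<close> vpos[of 0] by simp
  ultimately have sigma: "0 < (b 1)\<^sup>2 - 2 * b 2" "0 < C * v 0" .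
  show "sqrt (D / v 1) < first_pos_zero f"
    using bounds(1)[OF sigma] unfolding b by simp
  show "D * sqrt (E / ((v 1)\<^sup>2 * E - 2 * v 2 * D)) < (first_pos_zero f)\<^sup>2"
    using bounds(2)[OF sigma] unfolding b sqrt_inverse_sigma[OF pos(1,2)] .
qed

theorem corollary1:
  fixes \<nu> h h' h'' :: real
  assumes "\<bar>\<nu>\<bar> < 1 / 2"
    and "h = first_pos_zero (struve_H \<nu>)"
    and "h' = first_pos_zero (deriv (struve_H \<nu>))"
    and "h'' = first_pos_zero (deriv (deriv (struve_H \<nu>)))"
  shows "h > sqrt (3 * (2 * \<nu> + 3)) \<and>
         h\<^sup>2 > 3 * (2 * \<nu> + 3) * sqrt (5 * (2 * \<nu> + 5) / (7 - 2 * \<nu>)) \<and>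
         h' > sqrt (3 * (\<nu> + 1) * (2 * \<nu> + 3) / (\<nu> + 3)) \<and>
         h'\<^sup>2 > 3 * (\<nu> + 1) * (2 * \<nu> + 3) *
           sqrt (5 * (2 * \<nu> + 5) / (- 2 * \<nu> ^ 3 - 5 * \<nu>\<^sup>2 + 72 * \<nu> + 135)) \<and>
         (\<nu> > 0 \<longrightarrow>
           h'' > sqrt (3 * \<nu> * (\<nu> + 1) * (2 * \<nu> + 3) / ((\<nu> + 2) * (\<nu> + 3))) \<and>
           h''\<^sup>2 > 3 * \<nu> * (\<nu> + 1) * (2 * \<nu> + 3) *
           sqrt (5 * (2 * \<nu> + 5) /
             (- 2 * \<nu> ^ 5 - 13 * \<nu> ^ 4 + 92 * \<nu> ^ 3 + 763 * \<nu>\<^sup>2 + 1500 * \<nu> + 900)))"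
proof -
  have \<nu>: "- 1 / 2 < \<nu>" "\<nu> < 1 / 2" "- 3 / 2 < \<nu>" using assms(1) by auto
  define K where "K = (1 / 2) powr (\<nu> + 1) / (Gamma (3 / 2) * Gamma (\<nu> + 3 / 2))"
  have K: "0 < K" using \<nu> by (simp add: K_def)
  define c where "c m = (- 1) ^ m * struve_coeff \<nu> m" for m
  define c1 where "c1 m = (2 * real m + (\<nu> + 1)) * c m" for m
  define c2 where "c2 m = (2 * real m + \<nu>) * c1 m" for m
  have c: "summable (\<lambda>m. c m * y ^ m)" for y
    unfolding c_def by (rule summable_struve_coeff) (rule \<nu>)
  have c1: "summable (\<lambda>m. c1 m * y ^ m)" for y
    unfolding c1_def by (rule summable_mult_affine) (rule c)
  have c2: "summable (\<lambda>m. c2 m * y ^ m)" for y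
    unfolding c2_def by (rule summable_mult_affine) (rule c1)
  have H: "struve_H \<nu> x = K * frobenius_series (\<nu> + 1) c x" if "0 < x" for x
    using struve_H_eq_frobenius_series[OF \<nu>(3)] that by (simp add: K_def c_def[abs_def])
  have H': "deriv (struve_H \<nu>) x = K * frobenius_series \<nu> c1 x" if "0 < x" for x
    using deriv_frobenius_series[OF c H that] by (simp add: c1_def[abs_def])
  have H'': "deriv (deriv (struve_H \<nu>)) x = K * frobenius_series (\<nu> - 1) c2 x" if "0 < x" for x
    using deriv_frobenius_series[OF c1 H' that] by (simp add: c2_def[abs_def])
  define D where "D = 3 * (2 * \<nu> + 3)"
  define E where "E = 5 * (2 * \<nu> + 5)"
  have DE: "0 < D" "0 < E" "2 * D < E" using \<nu> by (simp_all add: D_def E_def)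

  obtain y where y: "0 < y" "struve_H \<nu> y = 0" using struve_H_zero[OF assms(1)] .
  have "frobenius_series (\<nu> + 1) c y = 0" using H[OF y(1)] y(2) K by simp
  then obtain y' where y': "0 < y'" "frobenius_series \<nu> c1 y' = 0"
    using frobenius_series_Rolle[OF c _ y(1), of "\<nu> + 1"] \<nu> by (auto simp: c1_def[abs_def])

  have b: "struve_coeff \<nu> 1 = 1 / D" "struve_coeff \<nu> 2 = 1 / (D * E)"
    by (simp_all add: D_def E_def eval_nat_numeral algebra_simps)
  have "0 < (\<Sum>m. c m * z ^ m)"
    if "0 < z" "((1 / D)\<^sup>2 - 2 * (1 / (D * E))) * z\<^sup>2 \<le> 1" for z
    unfolding c_def using that by (intro struve_series_pos assms(1)) (simp_all only: b)
  note pos = this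
  have sigma: "0 < (1 / D)\<^sup>2 - 2 * (1 / (D * E))"
    using DE by (simp add: field_simps power2_eq_square)
  have "0 < 1 / D" "0 < 1 / (D * E)" using DE by simp_all
  note bounds = first_pos_zero_bounds[OF this sigma K c H pos y]
  have h: "sqrt (1 / (1 / D)) < h" "sqrt (1 / ((1 / D)\<^sup>2 - 2 * (1 / (D * E)))) < h\<^sup>2"
    unfolding assms(2) using bounds by simp_all
  have "E - 2 * D = 7 - 2 * \<nu>" by (simp add: D_def E_def)
  hence h: "sqrt D < h" "D * sqrt (E / (7 - 2 * \<nu>)) < h\<^sup>2"
    using h sqrt_inverse_sigma[OF DE(1,2), of 1 1] by simp_all

  have sq: "\<nu>\<^sup>2 \<le> 1 / 4" "\<nu> * \<nu>\<^sup>2 \<le> 1 / 8"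
  proof -
    have "\<bar>\<nu>\<bar>\<^sup>2 \<le> (1 / 2)\<^sup>2" using assms(1) by (intro power_mono) auto
    thus "\<nu>\<^sup>2 \<le> 1 / 4" by (simp add: power_divide)
    moreover have "\<nu> * \<nu>\<^sup>2 \<le> 1 / 2 * \<nu>\<^sup>2" using \<nu> by (intro mult_right_mono) auto
    ultimately show "\<nu> * \<nu>\<^sup>2 \<le> 1 / 8" by simp
  qed
  \<comment> \<open>The two conditions on the coefficients of H_nu'. Both ratios increase with
    \<open>\<nu>\<close> and stay below 0.27 and 0.465, within the limits 5/18 and 47/100.\<close>
  have beta: "18 * (\<nu> + 5) * ((\<nu> + 1) * D) \<le> 5 * (\<nu> + 3)\<^sup>2 * E"
    using sq \<nu> by (simp add: D_def E_def algebra_simps power2_eq_square)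
  have kappa: "100 * (\<nu> + 3) * (\<nu> + 7) * E \<le> 47 * (\<nu> + 5)\<^sup>2 * (7 * (2 * \<nu> + 7))"
    using sq \<nu> by (simp add: E_def algebra_simps power2_eq_square)

  define v where "v m = 2 * real m + (\<nu> + 1)" for m
  have v: "v 0 = \<nu> + 1" "v 1 = \<nu> + 3" "v 2 = \<nu> + 5" "v 3 = \<nu> + 7" by (simp_all add: v_def)
  have vpos: "0 < v m" for m using \<nu> by (simp add: v_def)
  have vle: "v 0 * v (Suc m) \<le> v 1 * v m" for m by (simp add: v_def algebra_simps)
  have c1_eq: "c1 = (\<lambda>m. v m * ((- 1) ^ m * struve_coeff \<nu> m))"
    by (simp add: fun_eq_iff c1_def v_def c_def)
  have "deriv (struve_H \<nu>) y' = 0" using H'[OF y'(1)] y'(2) by simp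
  note bounds = weighted_struve_first_zero[OF assms(1) vpos vle _ _
      c1[unfolded c1_eq] H'[unfolded c1_eq] K y'(1) this,
      unfolded v, folded D_def E_def, OF beta kappa]
  have h': "sqrt ((\<nu> + 1) * D / (\<nu> + 3)) < h'"
    "(\<nu> + 1) * D * sqrt (E / ((\<nu> + 3)\<^sup>2 * E - 2 * (\<nu> + 5) * ((\<nu> + 1) * D))) < h'\<^sup>2"
    unfolding assms(3) using bounds by (simp_all only:)

  have h'': "sqrt (\<nu> * (\<nu> + 1) * D / ((\<nu> + 2) * (\<nu> + 3))) < h'' \<and>
    \<nu> * (\<nu> + 1) * D * sqrt (E / (((\<nu> + 2) * (\<nu> + 3))\<^sup>2 * E
      - 2 * ((\<nu> + 4) * (\<nu> + 5)) * (\<nu> * (\<nu> + 1) * D))) < h''\<^sup>2" if \<nu>_pos: "0 < \<nu>"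
  proof -
    \<comment> \<open>H_nu' has leading exponent \<open>\<nu>\<close>, so it vanishes at 0 and
      Rolle's theorem applies on [0, y'] thanks to \<open>0 < \<nu>\<close>.\<close>
    obtain y'' where y'': "0 < y''" "frobenius_series (\<nu> - 1) c2 y'' = 0"
      using frobenius_series_Rolle[OF c1 \<nu>_pos y'] by (auto simp: c2_def[abs_def])
    define u where "u m = (2 * real m + \<nu>) * v m" for m
    have u: "u 0 = \<nu> * (\<nu> + 1)" "u 1 = (\<nu> + 2) * (\<nu> + 3)" "u 2 = (\<nu> + 4) * (\<nu> + 5)"
      "u 3 = (\<nu> + 6) * (\<nu> + 7)" by (simp_all add: u_def v_def add.commute)
    have upos: "0 < u m" for m using \<nu>_pos vpos[of m] by (simp add: u_def)
    have ule: "u 0 * u (Suc m) \<le> u 1 * u m" for m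
    proof -
      have le: "\<nu> * (2 * real (Suc m) + \<nu>) \<le> (\<nu> + 2) * (2 * real m + \<nu>)" by (simp add: algebra_simps)
      have "\<nu> * (2 * real (Suc m) + \<nu>) * (v 0 * v (Suc m)) \<le> (\<nu> + 2) * (2 * real m + \<nu>) * (v 1 * v m)"
        by (rule mult_mono[OF le vle]) (use vpos[of 0] vpos[of "Suc m"] \<nu>_pos in simp_all)
      thus ?thesis by (simp add: u_def mult_ac add.commute)
    qed
    \<comment> \<open>The conditions for H_nu'' follow from those for H_nu' on multiplying by \<nu>
      (\<nu> + 4) \<le> (\<nu> + 2)^2 here and by (\<nu> + 2) (\<nu> + 6) \<le> (\<nu> + 4)^2
      below.\<close>
    have "18 * (\<nu> + 5) * ((\<nu> + 1) * D) * ((\<nu> + 4) * \<nu>) \<le> 5 * (\<nu> + 3)\<^sup>2 * E * (\<nu> + 2)\<^sup>2"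
      by (rule mult_mono[OF beta]) (use \<nu>_pos DE in \<open>simp_all add: power2_eq_square distrib_left distrib_right\<close>)
    hence beta: "18 * ((\<nu> + 4) * (\<nu> + 5)) * (\<nu> * (\<nu> + 1) * D) \<le> 5 * ((\<nu> + 2) * (\<nu> + 3))\<^sup>2 * E"
      by (simp add: power_mult_distrib mult_ac)
    have "100 * (\<nu> + 3) * (\<nu> + 7) * E * ((\<nu> + 2) * (\<nu> + 6)) \<le> 47 * (\<nu> + 5)\<^sup>2 * (7 * (2 * \<nu> + 7)) * (\<nu> + 4)\<^sup>2"
      by (rule mult_mono[OF kappa]) (use \<nu>_pos DE in \<open>simp_all add: power2_eq_square distrib_left distrib_right\<close>)
    hence kappa: "100 * ((\<nu> + 2) * (\<nu> + 3)) * ((\<nu> + 6) * (\<nu> + 7)) * E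
        \<le> 47 * ((\<nu> + 4) * (\<nu> + 5))\<^sup>2 * (7 * (2 * \<nu> + 7))"
      by (simp add: power_mult_distrib mult_ac)
    have c2_eq: "c2 = (\<lambda>m. u m * ((- 1) ^ m * struve_coeff \<nu> m))"
      by (simp add: fun_eq_iff c2_def c1_eq u_def)
    have "deriv (deriv (struve_H \<nu>)) y'' = 0" using H''[OF y''(1)] y''(2) by simp
    note bounds = weighted_struve_first_zero[OF assms(1) upos ule _ _
        c2[unfolded c2_eq] H''[unfolded c2_eq] K y''(1) this,
        unfolded u, folded D_def E_def, OF beta kappa]
    show ?thesis unfolding assms(4) using bounds by (simp only: simp_thms)
  qed

  have q': "(\<nu> + 3)\<^sup>2 * E - 2 * (\<nu> + 5) * ((\<nu> + 1) * D) = - 2 * \<nu> ^ 3 - 5 * \<nu>\<^sup>2 + 72 * \<nu> + 135"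
    unfolding D_def E_def by algebra
  have q'': "((\<nu> + 2) * (\<nu> + 3))\<^sup>2 * E - 2 * ((\<nu> + 4) * (\<nu> + 5)) * (\<nu> * (\<nu> + 1) * D)
      = - 2 * \<nu> ^ 5 - 13 * \<nu> ^ 4 + 92 * \<nu> ^ 3 + 763 * \<nu>\<^sup>2 + 1500 * \<nu> + 900"
    unfolding D_def E_def by algebra
  have D: "(\<nu> + 1) * D = 3 * (\<nu> + 1) * (2 * \<nu> + 3)" "\<nu> * (\<nu> + 1) * D = 3 * \<nu> * (\<nu> + 1) * (2 * \<nu> + 3)"
    unfolding D_def by (simp_all only: mult_ac)
  from h h' h'' show ?thesis
    unfolding q' q'' unfolding D unfolding D_def E_def by simp
qed

end
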